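(* Let $r \geq 2$ and $d \geq 0$ be integers, and set $D = d+1$ and $T = D(r-1)$. Let $a_1, \ldots, a_r$ be indeterminates, and let $\mathsf{V}$ be the generalized Sylvester-Vandermonde matrix, i.e. the $Dr \times Dr$ matrix whose rows are, in order, the coefficient vectors of the polynomials $$(x+a_1)^T, x(x+a_1)^T, \ldots, x^d(x+a_1)^T,\; (x+a_2)^T, \ldots, x^d(x+a_2)^T,\; \ldots,\; (x+a_r)^T, \ldots, x^d(x+a_r)^T$$ in $x$, with coefficients listed in order of increasing powers $x^0, x^1, \ldots, x^{T+d}$. Then, as an identity of polynomials in $a_1, \ldots, a_r$, $$\det(\mathsf{V}) = C \cdot \prod_{1 \leq i < j \leq r} (a_i - a_j)^{D^2}, \qquad \text{where} \qquad C = \frac{\prod_{\ell=0}^{T+d} \binom{T+d}{\ell}}{\prod_{j=0}^{d} \binom{T+d}{j}^{r}} .$$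
   Context: The matrix $\mathsf{V}$ is square because the number of columns is $T + d + 1 = T + D = Dr$. Explicitly, index the rows by pairs $(i,j)$ with $1 \leq i \leq r$, $0 \leq j \leq d$, ordered lexicographically, and the columns by $q = 0, 1, \ldots, T+d$. The entry of $\mathsf{V}$ in row $(i,j)$ and column $q$ is the coefficient of $x^q$ in $x^j (x+a_i)^T$, namely $\binom{T}{T-(q-j)} a_i^{T-(q-j)}$ if $0 \leq q - j \leq T$, and $0$ otherwise. The identity is understood in the polynomial ring $\mathbb{Q}[a_1, \ldots, a_r]$. *)

theory Defs
  imports
    "HOL-Library.Poly_Mapping"
    "HOL-Computational_Algebra.Polynomial"
    "Jordan_Normal_Form.Determinant"
begin

text \<open>
  Exponent vectors are finitely supported functions \<open>nat \<Rightarrow>\<^sub>0 nat\<close>, so \<open>mpoly_rat\<close> is the polynomial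
  ring over the rationals in indeterminates indexed by \<open>nat\<close>; it contains
  \<open>\<rat>[a\<^sub>1, \<dots>, a\<^sub>r]\<close> as a subring.
\<close>

type_synonym mpoly_rat = "(nat \<Rightarrow>\<^sub>0 nat) \<Rightarrow>\<^sub>0 rat"

definition indet :: "nat \<Rightarrow> mpoly_rat" where
  "indet i = Poly_Mapping.single (Poly_Mapping.single i 1) 1"

definition scalar :: "rat \<Rightarrow> mpoly_rat" where
  "scalar c = Poly_Mapping.single 0 c"

text \<open>
  The block of rows for \<open>a\<^sub>i\<close>, \<open>1 \<le> i \<le> r\<close>, consists of the (zero-based) rows
  \<open>(i - 1) * (d + 1) + j\<close> with \<open>0 \<le> j \<le> d\<close>.
\<close>

definition sylvester_vandermonde :: "nat \<Rightarrow> nat \<Rightarrow> mpoly_rat mat" where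
  "sylvester_vandermonde r d =
    (let D = d + 1; T = D * (r - 1) in
      mat (D * r) (D * r)
        (\<lambda>(k, q). coeff (monom 1 (k mod D) * [:indet (k div D + 1), 1:] ^ T) q))"

end

theory Submission imports Defs begin

text \<open>
  Write \<open>n = D r\<close> and \<open>N = T + d = n - 1\<close>. Expanding \<open>x = (x + a\<^sub>i) - a\<^sub>i\<close>, a unitriangular row
  operation inside each block replaces \<open>x\<^sup>j (x + a\<^sub>i)\<^sup>T\<close> by \<open>(x + a\<^sub>i)\<^bsup>T + j\<^esup> = (x + a\<^sub>i)\<^bsup>N - (d - j)\<^esup>\<close>.
  By the trinomial revision \<open>(N choose k) (N - k choose q) = (N choose q) (N - q choose k)\<close>,
  scaling its rows by \<open>N choose (d - j)\<close> gives a confluent Vandermonde matrix, whose entry at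
  \<open>((i, j), q)\<close> is the coefficient of \<open>x\<^bsup>d - j\<^esup>\<close> in \<open>(x + a\<^sub>i)\<^bsup>N - q\<^esup>\<close>, with its columns scaled by
  \<open>N choose q\<close>. Replacing the monomials \<open>x\<^bsup>N - q\<^esup>\<close> by the Newton polynomials whose roots are the
  nodes of the rows after \<open>q\<close>, again a unitriangular operation, makes the confluent Vandermonde
  matrix triangular.
\<close>

section \<open>Sums and products over blocks of indices\<close>

text \<open>Stated in \<open>comm_monoid_set\<close> so that one proof serves both the sums in
  matrix products and the products over rows grouped by node.\<close>

lemma (in comm_monoid_set) nat_group_div_mod:
  fixes D r :: nat
  shows "F (\<lambda>k. g (k div D) (k mod D)) {..<r * D} = F (\<lambda>i. F (\<lambda>j. g i j) {..<D}) {..<r}"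
proof -
  have "F (\<lambda>k. g (k div D) (k mod D)) {i * D..<i * D + D} = F (\<lambda>j. g i j) {..<D}" for i
  proof (rule reindex_bij_witness[where j = "\<lambda>k. k - i * D" and i = "\<lambda>j. j + i * D"])
    fix k assume "k \<in> {i * D..<i * D + D}"
    then have "k div D = i"
      by (intro div_nat_eqI) (auto simp: algebra_simps)
    then show "g i (k - i * D) = g (k div D) (k mod D)"
      by (auto simp: minus_div_mult_eq_mod[symmetric])
  qed auto
  then show ?thesis
    by (simp flip: nat_group)
qed

lemma prod_div_interval:
  fixes g :: "nat \<Rightarrow> 'a :: comm_monoid_mult"
  assumes "s \<le> r"
  shows "(\<Prod>m = s * D..<r * D. g (m div D)) = (\<Prod>j = s..<r. g j ^ D)"
  using assms
proof (induction r rule: dec_induct)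
  case base
  then show ?case by simp
next
  case (step r)
  have "(\<Prod>m = r * D..<Suc r * D. g (m div D)) = (\<Prod>m = r * D..<Suc r * D. g r)"
    by (intro prod.cong) (auto simp: div_nat_eqI algebra_simps)
  moreover have "(\<Prod>m = s * D..<Suc r * D. g (m div D)) =
      (\<Prod>m = s * D..<r * D. g (m div D)) * (\<Prod>m = r * D..<Suc r * D. g (m div D))"
    by (rule prod.atLeastLessThan_concat[symmetric]) (use step in auto)
  ultimately show ?case
    using step by simp
qed

section \<open>Composition and monic products of polynomials\<close>

lemma pcompose_eq_sum:
  fixes p q :: "'a :: comm_ring_1 poly"
  assumes "degree p < n"
  shows "pcompose p q = (\<Sum>k<n. smult (coeff p k) (q ^ k))"
proof -
  have "pcompose p q = (\<Sum>k\<le>degree p. smult (coeff p k) (q ^ k))"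
    by (simp add: pcompose_altdef poly_altdef coeff_map_poly degree_map_poly)
  also have "\<dots> = (\<Sum>k<n. smult (coeff p k) (q ^ k))"
    using assms by (intro sum.mono_neutral_left) (auto simp: coeff_eq_0)
  finally show ?thesis .
qed

text \<open>Degrees of products need not add over a ring with zero divisors, so the leading
  coefficient is carried through the induction and pins the degree.\<close>

lemma prod_monic_linear:
  fixes f :: "'b \<Rightarrow> 'a :: comm_ring_1"
  assumes "finite A"
  shows "degree (\<Prod>m\<in>A. [:f m, 1:]) = card A \<and> coeff (\<Prod>m\<in>A. [:f m, 1:]) (card A) = 1"
  using assms
proof (induction A rule: finite_induct)
  case empty
  then show ?case by simp
next
  case (insert m A)
  let ?p = "\<Prod>m\<in>A. [:f m, 1:]"
  have eq: "(\<Prod>m\<in>insert m A. [:f m, 1:]) = smult (f m) ?p + pCons 0 ?p"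
    using insert by simp
  have c: "coeff (\<Prod>m\<in>insert m A. [:f m, 1:]) (card (insert m A)) = 1"
    unfolding eq using insert by (simp add: coeff_eq_0)
  have "degree (\<Prod>m\<in>insert m A. [:f m, 1:]) \<le> card (insert m A)"
    unfolding eq using insert
    by (intro degree_add_le order.trans[OF degree_smult_le] order.trans[OF degree_pCons_le]) auto
  with c show ?case
    by (metis le_antisym le_degree zero_neq_one)
qed

section \<open>Determinants of matrices given by entry functions\<close>

lemma mat_mult_mat:
  "mat n n f * mat n n g = mat n n (\<lambda>(i, j). \<Sum>l<n. f (i, l) * g (l, j))"
  by (rule eq_matI) (auto simp: scalar_prod_def atLeast0LessThan intro!: sum.cong)

lemma det_mat_upper:
  assumes "\<And>i j. j < i \<Longrightarrow> i < n \<Longrightarrow> f (i, j) = 0"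
  shows "det (mat n n f) = (\<Prod>i<n. f (i, i))"
  by (subst det_upper_triangular[of _ n])
     (auto simp: prod_list_diag_prod atLeast0LessThan assms intro!: prod.cong upper_triangularI)

lemma det_mat_lower:
  assumes "\<And>i j. i < j \<Longrightarrow> j < n \<Longrightarrow> f (i, j) = 0"
  shows "det (mat n n f) = (\<Prod>i<n. f (i, i))"
  by (subst det_lower_triangular[of n])
     (auto simp: prod_list_diag_prod atLeast0LessThan assms intro!: prod.cong)

lemma det_scale_rows:
  "det (mat n n (\<lambda>(i, j). c i * f i j)) = (\<Prod>i<n. c i) * det (mat n n (\<lambda>(i, j). f i j))"
proof -
  let ?d = "\<lambda>(i, j). if i = j then c i else 0"
  have "mat n n (\<lambda>(i, j). c i * f i j) = mat n n ?d * mat n n (\<lambda>(i, j). f i j)"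
    unfolding mat_mult_mat by (rule eq_matI) (auto simp: if_distrib if_distribR cong: if_cong)
  then show ?thesis
    by (simp add: det_mult[of _ n] det_mat_upper)
qed

lemma det_scale_cols:
  "det (mat n n (\<lambda>(i, j). c j * f i j)) = (\<Prod>j<n. c j) * det (mat n n (\<lambda>(i, j). f i j))"
proof -
  have t: "transpose_mat (mat n n (\<lambda>(i, j). f i j)) = mat n n (\<lambda>(i, j). f j i)" for f :: "nat \<Rightarrow> nat \<Rightarrow> 'a"
    by (rule eq_matI) auto
  have "det (mat n n (\<lambda>(i, j). c j * f i j)) = det (mat n n (\<lambda>(i, j). c i * f j i))"
    by (subst det_transpose[symmetric, of _ n]) (auto simp: t)
  also have "\<dots> = (\<Prod>j<n. c j) * det (mat n n (\<lambda>(i, j). f j i))"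
    by (rule det_scale_rows)
  also have "det (mat n n (\<lambda>(i, j). f j i)) = det (mat n n (\<lambda>(i, j). f i j))"
    by (subst det_transpose[symmetric, of _ n]) (auto simp: t)
  finally show ?thesis .
qed

section \<open>The confluent Vandermonde determinant\<close>

text \<open>Row \<open>k\<close> reads off the Taylor coefficient of order
  \<open>D - Suc (k mod D)\<close> at the node \<open>a (k div D)\<close>. Orders fall along a
  block, so this order is the number of later rows in the block; on Newton polynomials the matrix
  therefore becomes upper triangular.\<close>

lemma det_confluent_vandermonde:
  fixes a :: "nat \<Rightarrow> 'a :: comm_ring_1"
  assumes "D > 0"
  shows "det (mat (r * D) (r * D)
      (\<lambda>(k, q). coeff ([:a (k div D), 1:] ^ (r * D - Suc q)) (D - Suc (k mod D)))) =
    (\<Prod>i<r. \<Prod>j = Suc i..<r. (a i - a j) ^ D\<^sup>2)"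
proof -
  define n where "n = r * D"
  define P where "P q = (\<Prod>m\<in>{q<..<n}. [:- a (m div D), 1:])" for q
  let ?E = "\<lambda>(k, q). coeff ([:a (k div D), 1:] ^ (n - Suc q)) (D - Suc (k mod D))"
  let ?U = "\<lambda>(l, q). coeff (P q) (n - Suc l)"
  let ?L = "\<lambda>(k, q). coeff (pcompose (P q) [:a (k div D), 1:]) (D - Suc (k mod D))"
  have P: "degree (P q) = n - Suc q" "coeff (P q) (n - Suc q) = 1" for q
    using prod_monic_linear[of "{q<..<n}" "\<lambda>m. - a (m div D)"] by (simp_all add: P_def)
  have "det (mat n n ?U) = (\<Prod>q<n. ?U (q, q))"
    by (rule det_mat_lower) (auto simp: P intro!: coeff_eq_0)
  then have U: "det (mat n n ?U) = 1"
    by (simp add: P)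
  have L_eq: "pcompose (P q) [:c, 1:] = (\<Prod>m\<in>{q<..<n}. [:c - a (m div D), 1:])" for q c
    by (simp add: P_def pcompose_prod pcompose_pCons)
  have EU: "mat n n ?E * mat n n ?U = mat n n ?L"
    unfolding mat_mult_mat
  proof (rule eq_matI; clarsimp)
    fix k q assume "k < n" "q < n"
    have "pcompose (P q) [:a (k div D), 1:] =
        (\<Sum>l<n. smult (coeff (P q) l) ([:a (k div D), 1:] ^ l))"
      using \<open>q < n\<close> by (intro pcompose_eq_sum) (auto simp: P)
    \<comment> \<open>The monomial columns stand in decreasing degree, hence the reversed
      index.\<close>
    also have "\<dots> = (\<Sum>l<n. smult (coeff (P q) (n - Suc l)) ([:a (k div D), 1:] ^ (n - Suc l)))"
      by (rule sum.nat_diff_reindex[symmetric])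
    finally show "(\<Sum>l<n. coeff ([:a (k div D), 1:] ^ (n - Suc l)) (D - Suc (k mod D)) * coeff (P q) (n - Suc l)) =
        coeff (pcompose (P q) [:a (k div D), 1:]) (D - Suc (k mod D))"
      by (simp add: coeff_sum mult.commute)
  qed
  \<comment> \<open>The rows after \<open>k\<close> in its block share its node, so each of their
    factors becomes \<open>x\<close> after the shift.\<close>
  have split: "(\<Prod>m\<in>{k<..<n}. [:a (k div D) - a (m div D), 1:]) =
      monom 1 (D - Suc (k mod D)) * (\<Prod>m\<in>{Suc (k div D) * D..<n}. [:a (k div D) - a (m div D), 1:])"
    and block_le: "Suc (k div D) * D \<le> n" if "k < n" for k
  proof -
    have md: "k mod D < D" "k div D * D + k mod D = k"
      using assms by auto
    have nb: "Suc k + (D - Suc (k mod D)) = Suc (k div D) * D"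
      using md unfolding mult_Suc by linarith
    have "k div D < r"
      using that by (simp add: n_def less_mult_imp_div_less)
    then show le: "Suc (k div D) * D \<le> n"
      unfolding n_def by (intro mult_le_mono1) simp
    have const: "m div D = k div D" if "m \<in> {Suc k..<Suc (k div D) * D}" for m
    proof (rule div_nat_eqI)
      show "D * (k div D) \<le> m" "m < D * Suc (k div D)"
        using that md unfolding mult.commute[of D] atLeastLessThan_iff by linarith+
    qed
    have "(\<Prod>m\<in>{k<..<n}. [:a (k div D) - a (m div D), 1:]) =
        (\<Prod>m = Suc k..<Suc (k div D) * D. [:a (k div D) - a (m div D), 1:]) *
        (\<Prod>m = Suc (k div D) * D..<n. [:a (k div D) - a (m div D), 1:])"
      unfolding atLeastSucLessThan_greaterThanLessThan[symmetric]
      by (rule prod.atLeastLessThan_concat[symmetric]) (use nb le in linarith)+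
    moreover have "(\<Prod>m = Suc k..<Suc (k div D) * D. [:a (k div D) - a (m div D), 1:]) =
        monom 1 (D - Suc (k mod D))"
    proof -
      have "(\<Prod>m = Suc k..<Suc (k div D) * D. [:a (k div D) - a (m div D), 1:]) =
          (\<Prod>m = Suc k..<Suc (k div D) * D. monom 1 1)"
        by (intro prod.cong refl, subst const) (simp_all add: monom_Suc)
      also have "\<dots> = monom 1 1 ^ (D - Suc (k mod D))"
        unfolding prod_constant nb[symmetric] by simp
      finally show ?thesis
        by (simp only: monom_power mult_1 power_one)
    qed
    ultimately show "(\<Prod>m\<in>{k<..<n}. [:a (k div D) - a (m div D), 1:]) =
      monom 1 (D - Suc (k mod D)) * (\<Prod>m\<in>{Suc (k div D) * D..<n}. [:a (k div D) - a (m div D), 1:])"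
      by (simp only:)
  qed
  \<comment> \<open>For \<open>q < k\<close> the factor of row \<open>k\<close> itself adds one more
    \<open>x\<close>, beyond the order being read.\<close>
  have below: "?L (k, q) = 0" if "q < k" "k < n" for k q
  proof -
    let ?f = "\<lambda>m. [:a (k div D) - a (m div D), 1:]"
    define A where "A = prod ?f {q<..<k}"
    define B where "B = prod ?f {Suc (k div D) * D..<n}"
    have "{q<..<n} = {q<..<k} \<union> insert k {k<..<n}"
      using that by auto
    then have "prod f {q<..<n} = prod f {q<..<k} * (f k * prod f {k<..<n})" for f :: "nat \<Rightarrow> 'a poly"
      by (subst \<open>{q<..<n} = _\<close>, subst prod.union_disjoint) auto
    then have "prod ?f {q<..<n} = A * (?f k * (monom 1 (D - Suc (k mod D)) * B))"
      unfolding A_def B_def split[OF \<open>k < n\<close>, symmetric] .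
    also have "?f k = monom 1 1"
      by (simp add: monom_Suc)
    also have "A * (monom 1 1 * (monom 1 (D - Suc (k mod D)) * B)) =
        monom 1 (Suc (D - Suc (k mod D))) * (A * B)"
      by (simp only: mult.assoc[symmetric] mult_monom mult.commute[of A]) simp
    finally have "?L (k, q) = coeff (monom 1 (Suc (D - Suc (k mod D))) * (A * B)) (D - Suc (k mod D))"
      unfolding L_eq prod.case by (rule arg_cong)
    then show ?thesis
      by (simp only: coeff_monom_mult) simp
  qed
  \<comment> \<open>Here the power of \<open>x\<close> equals the order being read, which leaves the
    constant term of the other factors.\<close>
  have diag: "?L (k, k) = (\<Prod>j = Suc (k div D)..<r. (a (k div D) - a j) ^ D)" if "k < n" for k
  proof -
    have coeff: "coeff (monom 1 e * p) e = poly p 0" for e and p :: "'a poly"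
      by (simp add: coeff_monom_mult poly_0_coeff_0)
    have "?L (k, k) = poly (\<Prod>m\<in>{Suc (k div D) * D..<n}. [:a (k div D) - a (m div D), 1:]) 0"
      unfolding L_eq prod.case split[OF that] by (rule coeff)
    also have "\<dots> = (\<Prod>m\<in>{Suc (k div D) * D..<r * D}. a (k div D) - a (m div D))"
      by (simp add: poly_prod n_def del: mult_Suc)
    also have "\<dots> = (\<Prod>j = Suc (k div D)..<r. (a (k div D) - a j) ^ D)"
      using block_le[OF that] assms by (intro prod_div_interval) (simp add: n_def del: mult_Suc)
    finally show ?thesis .
  qed
  have "det (mat n n ?E) = det (mat n n ?E * mat n n ?U)"
    by (simp add: det_mult[of _ n] U)
  also have "\<dots> = (\<Prod>k<n. ?L (k, k))"
    unfolding EU by (rule det_mat_upper) (rule below)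
  also have "\<dots> = (\<Prod>k<n. \<Prod>j = Suc (k div D)..<r. (a (k div D) - a j) ^ D)"
    using diag by (intro prod.cong) auto
  \<comment> \<open>All \<open>D\<close> rows of a block share one diagonal entry, which turns the
    exponent \<open>D\<close> into \<open>D\<^sup>2\<close>.\<close>
  also have "\<dots> = (\<Prod>i<r. (\<Prod>j = Suc i..<r. (a i - a j) ^ D) ^ D)"
    unfolding n_def
    using prod.nat_group_div_mod[of "\<lambda>i _. \<Prod>j = Suc i..<r. (a i - a j) ^ D" D r] by simp
  also have "\<dots> = (\<Prod>i<r. \<Prod>j = Suc i..<r. (a i - a j) ^ D\<^sup>2)"
    by (simp add: prod_power_distrib power2_eq_square power_mult)
  finally show ?thesis
    by (simp add: n_def)
qed

section \<open>Trading binomial factors between rows and columns\<close>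

text \<open>Both sides count pairs of disjoint subsets of sizes \<open>k\<close> and
  \<open>q\<close> in a set of size \<open>N\<close>; they vanish if
  \<open>k + q > N\<close>.\<close>

lemma trinomial_revision_symmetric:
  fixes N k q :: nat
  assumes "k \<le> N" "q \<le> N"
  shows "(N choose k) * (N - k choose q) = (N choose q) * (N - q choose k)"
proof (cases "k + q \<le> N")
  case True
  have "(N choose (k + q)) * (k + q choose k) = (N choose k) * (N - k choose q)"
    "(N choose (k + q)) * (k + q choose q) = (N choose q) * (N - q choose k)"
    using choose_mult[of k "k + q" N] choose_mult[of q "k + q" N] True by simp_all
  then show ?thesis
    using binomial_symmetric[of k "k + q"] by simp
qed (use assms in \<open>simp add: binomial_eq_0\<close>)

text \<open>The row factors stay on the left because binomial coefficients need not be invertible in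
  a commutative ring.\<close>

lemma det_linear_powers:
  fixes a :: "nat \<Rightarrow> 'a :: comm_ring_1"
  assumes "D > 0" "r > 0"
  defines "N \<equiv> r * D - 1"
  shows "(\<Prod>j<D. of_nat (N choose j)) ^ r *
      det (mat (r * D) (r * D) (\<lambda>(k, q). coeff ([:a (k div D), 1:] ^ (D * (r - 1) + k mod D)) q)) =
    (\<Prod>q\<le>N. of_nat (N choose q)) * (\<Prod>i<r. \<Prod>j = Suc i..<r. (a i - a j) ^ D\<^sup>2)"
proof -
  define n where "n = r * D"
  have n: "n = D * (r - 1) + D"
    using assms(2) by (cases r) (simp_all add: n_def)
  with assms(1) have n_Suc: "n = Suc N"
    by (simp add: n_def N_def)
  let ?c = "\<lambda>k. of_nat (N choose (D - Suc (k mod D)))"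
  let ?f = "\<lambda>k q. coeff ([:a (k div D), 1:] ^ (D * (r - 1) + k mod D)) q"
  let ?g = "\<lambda>k q. coeff ([:a (k div D), 1:] ^ (n - Suc q)) (D - Suc (k mod D))"
  have coeff_pow: "coeff ([:x, 1:] ^ m) i = of_nat (m choose i) * x ^ (m - i)" for x :: 'a and m i
    by (cases "i \<le> m") (simp_all add: coeff_linear_poly_power binomial_eq_0 coeff_eq_0 degree_linear_power)
  \<comment> \<open>Both coefficients carry the node to the power \<open>N - j - q\<close>, so only
    the binomial factors have to be compared.\<close>
  have entry: "?c k * ?f k q = of_nat (N choose q) * ?g k q" if "k < n" "q < n" for k q
  proof -
    define j where "j = D - Suc (k mod D)"
    have "k mod D < D" using assms by simp
    then have exp: "D * (r - 1) + k mod D = N - j" and "j \<le> N"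
      using n n_Suc unfolding j_def by linarith+
    have "n - Suc q = N - q" using n_Suc by simp
    have "(of_nat (N choose j) :: 'a) * of_nat (N - j choose q) = of_nat (N choose q) * of_nat (N - q choose j)"
      unfolding of_nat_mult[symmetric]
      using trinomial_revision_symmetric[of j N q] \<open>j \<le> N\<close> that n_Suc by simp
    then show ?thesis
      unfolding exp \<open>n - Suc q = N - q\<close> j_def[symmetric] coeff_pow
      by (simp only: mult.assoc[symmetric] diff_commute[of N j q])
  qed
  have "(\<Prod>k<n. ?c k :: 'a) = (\<Prod>i<r. \<Prod>j<D. of_nat (N choose (D - Suc j)))"
    unfolding n_def by (rule prod.nat_group_div_mod)
  also have "\<dots> = (\<Prod>j<D. of_nat (N choose j)) ^ r"
    by (simp add: prod.nat_diff_reindex[of "\<lambda>j. of_nat (N choose j)"])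
  finally have "(\<Prod>j<D. of_nat (N choose j)) ^ r * det (mat n n (\<lambda>(k, q). ?f k q)) =
      det (mat n n (\<lambda>(k, q). ?c k * ?f k q))"
    by (simp add: det_scale_rows)
  also have "mat n n (\<lambda>(k, q). ?c k * ?f k q) = mat n n (\<lambda>(k, q). of_nat (N choose q) * ?g k q)"
    using entry by (intro cong_mat) auto
  also have "det \<dots> = (\<Prod>q<n. of_nat (N choose q)) * det (mat n n (\<lambda>(k, q). ?g k q))"
    by (rule det_scale_cols)
  also have "{..<n} = {..N}"
    using n_Suc by auto
  finally show ?thesis
    using det_confluent_vandermonde[OF assms(1), of r a] by (simp add: n_def)
qed

section \<open>The row operation inside each block\<close>

text \<open>The change of rows is block diagonal: writing \<open>x\<close> to the power
  \<open>j\<close> in powers of \<open>x + a\<close> uses the coefficients of \<open>x - a\<close>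
  to the power \<open>j\<close>, which form a unitriangular block.\<close>

lemma det_sylvester_vandermonde_linear_powers:
  fixes a :: "nat \<Rightarrow> 'a :: comm_ring_1"
  assumes "D > 0"
  shows "det (mat (r * D) (r * D) (\<lambda>(k, q). coeff (monom 1 (k mod D) * [:a (k div D), 1:] ^ T) q)) =
    det (mat (r * D) (r * D) (\<lambda>(k, q). coeff ([:a (k div D), 1:] ^ (T + k mod D)) q))"
proof -
  define n where "n = r * D"
  let ?V = "\<lambda>(k, q). coeff (monom 1 (k mod D) * [:a (k div D), 1:] ^ T) q"
  let ?W = "\<lambda>(k, q). coeff ([:a (k div D), 1:] ^ (T + k mod D)) q"
  let ?R = "\<lambda>(k, l). if l div D = k div D then coeff ([:- a (k div D), 1:] ^ (k mod D)) (l mod D) else 0"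
  have expand: "monom 1 j = (\<Sum>l<D. smult (coeff ([:- c, 1:] ^ j) l) ([:c, 1:] ^ l))"
    if "j < D" for j and c :: 'a
  proof -
    have "monom 1 j = pcompose ([:- c, 1:] ^ j) [:c, 1:]"
      by (induction j)
        (simp_all only: power_0 power_Suc pcompose_1 pcompose_mult monom_Suc, simp_all add: pcompose_pCons)
    also have "\<dots> = (\<Sum>l<D. smult (coeff ([:- c, 1:] ^ j) l) ([:c, 1:] ^ l))"
      using that by (intro pcompose_eq_sum) (simp add: degree_linear_power)
    finally show ?thesis .
  qed
  have "mat n n ?V = mat n n ?R * mat n n ?W"
    unfolding mat_mult_mat
  proof (rule eq_matI; clarsimp)
    fix k q assume "k < n" "q < n"
    define i where "i = k div D"
    have "i < r"
      using \<open>k < n\<close> by (simp add: i_def n_def less_mult_imp_div_less)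
    let ?h = "\<lambda>m l. (if m = i then coeff ([:- a i, 1:] ^ (k mod D)) l else 0) *
      coeff ([:a m, 1:] ^ (T + l)) q"
    have "(\<Sum>l<n. ?h (l div D) (l mod D)) = (\<Sum>m<r. \<Sum>l<D. ?h m l)"
      unfolding n_def by (rule sum.nat_group_div_mod)
    also have "\<dots> = (\<Sum>m<r. if m = i then \<Sum>l<D. coeff ([:- a i, 1:] ^ (k mod D)) l *
      coeff ([:a i, 1:] ^ (T + l)) q else 0)"
      by (intro sum.cong) auto
    also have "\<dots> = (\<Sum>l<D. coeff ([:- a i, 1:] ^ (k mod D)) l * coeff ([:a i, 1:] ^ (T + l)) q)"
      using \<open>i < r\<close> by simp
    also have "\<dots> = coeff (monom 1 (k mod D) * [:a i, 1:] ^ T) q"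
      using assms by (subst expand[of _ "a i"])
        (simp_all add: sum_distrib_left coeff_sum power_add mult_ac)
    finally show "coeff (monom 1 (k mod D) * [:a (k div D), 1:] ^ T) q =
      (\<Sum>l<n. (if l div D = k div D then coeff ([:- a (k div D), 1:] ^ (k mod D)) (l mod D) else 0) *
         coeff ([:a (l div D), 1:] ^ (T + l mod D)) q)"
      unfolding i_def by (rule sym)
  qed
  \<comment> \<open>Within a block, remainders are ordered like indices, so above the diagonal
    \<open>l mod D\<close> exceeds the degree \<open>k mod D\<close>.\<close>
  moreover have "det (mat n n ?R) = (\<Prod>k<n. ?R (k, k))"
  proof (rule det_mat_lower)
    fix k l :: nat assume "k < l"
    then have "k mod D < l mod D" if "l div D = k div D"
      using that by (metis div_mult_mod_eq nat_add_left_cancel_less)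
    then show "?R (k, l) = 0"
      by (auto intro!: coeff_eq_0 simp: degree_linear_power)
  qed
  ultimately show ?thesis
    by (simp add: n_def det_mult[of _ "r * D"] coeff_linear_power)
qed

lemma det_sylvester_vandermonde:
  fixes a :: "nat \<Rightarrow> 'a :: comm_ring_1"
  assumes "D > 0" "r > 0"
  defines "N \<equiv> r * D - 1"
  shows "(\<Prod>j<D. of_nat (N choose j)) ^ r * det (mat (r * D) (r * D)
      (\<lambda>(k, q). coeff (monom 1 (k mod D) * [:a (k div D), 1:] ^ (D * (r - 1))) q)) =
    (\<Prod>q\<le>N. of_nat (N choose q)) * (\<Prod>i<r. \<Prod>j = Suc i..<r. (a i - a j) ^ D\<^sup>2)"
  unfolding det_sylvester_vandermonde_linear_powers[OF assms(1)]
  using det_linear_powers[OF assms(1,2)] by (simp add: N_def)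

section \<open>Passage to rational polynomials\<close>

lemma scalar_mult: "scalar (x * y) = scalar x * scalar y"
  by (simp add: scalar_def mult_single)

lemma scalar_1: "scalar 1 = 1"
  by (simp add: scalar_def)

lemma scalar_of_nat: "scalar (of_nat n) = of_nat n"
  by (simp add: scalar_def)

theorem lemma3p1:
  fixes r d D T :: nat and C :: rat
  assumes "r \<ge> 2"
    and "D = d + 1"
    and "T = D * (r - 1)"
    and "C = (\<Prod>l = 0..T + d. of_nat ((T + d) choose l)) /
             (\<Prod>j = 0..d. of_nat ((T + d) choose j) ^ r)"
  shows "det (sylvester_vandermonde r d) =
    scalar C * (\<Prod>(i, j) \<in> {(i, j). 1 \<le> i \<and> i < j \<and> j \<le> r}. (indet i - indet j) ^ (D\<^sup>2))"
proof -
  define N where "N = T + d"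
  have N: "N = r * D - 1"
    using assms by (cases r) (auto simp: N_def)
  \<comment> \<open>Numerator and denominator of \<open>C\<close> are kept as naturals, so that
    \<open>of_nat\<close> embeds them in \<open>mpoly_rat\<close> as well as in the
    rationals.\<close>
  define p :: nat where "p = (\<Prod>q\<le>N. N choose q)"
  define s :: nat where "s = (\<Prod>j<D. N choose j) ^ r"
  \<comment> \<open>Hence every \<open>j < D\<close> is at most \<open>N\<close>, and no binomial
    factor of \<open>s\<close> vanishes.\<close>
  have "d \<le> N" by (simp add: N_def)
  then have "s \<noteq> 0"
    using assms(2) by (auto simp: s_def)
  have C: "C = of_nat p / of_nat s"
    using assms(2,4) by (simp add: p_def s_def N_def atLeast0AtMost lessThan_Suc_atMost prod_power_distrib)
  let ?M = "\<Prod>(i, j) \<in> {(i, j). 1 \<le> i \<and> i < j \<and> j \<le> r}. (indet i - indet j) ^ (D\<^sup>2)"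
  have "?M = (\<Prod>(i, j) \<in> (SIGMA i:{..<r}. {Suc i..<r}). (indet (i + 1) - indet (j + 1)) ^ D\<^sup>2)"
    by (rule prod.reindex_bij_witness[where j = "\<lambda>(i, j). (i - 1, j - 1)" and i = "\<lambda>(i, j). (i + 1, j + 1)"])
       auto
  then have M: "?M = (\<Prod>i<r. \<Prod>j = Suc i..<r. (indet (i + 1) - indet (j + 1)) ^ D\<^sup>2)"
    by (simp add: prod.Sigma)
  have "of_nat s * det (sylvester_vandermonde r d) = of_nat p * ?M"
    unfolding M s_def p_def of_nat_power of_nat_prod sylvester_vandermonde_def Let_def
      assms(2)[symmetric] N mult.commute[of D r]
    by (rule det_sylvester_vandermonde) (use assms in auto)
  \<comment> \<open>\<open>mpoly_rat\<close> is not a field, but the inverse of \<open>s\<close>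
    exists among the scalars.\<close>
  then have "scalar (1 / of_nat s) * (scalar (of_nat s) * det (sylvester_vandermonde r d)) =
      scalar (1 / of_nat s) * (scalar (of_nat p) * ?M)"
    by (simp only: scalar_of_nat)
  then show ?thesis
    using \<open>s \<noteq> 0\<close> by (simp add: C scalar_1 flip: mult.assoc scalar_mult)
qed

end
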